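(* There is a tall $F_\sigma$ ideal $\mathcal{I}$ on $\mathbb{N}$ which does not have a Borel selector.
   Context: Subsets of $\mathbb{N}$ are identified with elements of $2^{\mathbb{N}}$ (with the product topology). An ideal on $\mathbb{N}$ is a family $\mathcal{I}\subseteq 2^{\mathbb{N}}$ that is hereditary (if $y\subseteq x\in\mathcal{I}$ then $y\in\mathcal{I}$) and closed under finite unions; it is $F_\sigma$ if it is an $F_\sigma$ subset of $2^{\mathbb{N}}$. A family $\mathcal{C}\subseteq 2^{\mathbb{N}}$ is tall if every infinite $x\subseteq\mathbb{N}$ has an infinite subset $y\in\mathcal{C}$. A Borel selector for a tall family $\mathcal{C}$ is a Borel function $S:2^{\mathbb{N}}\to 2^{\mathbb{N}}$ such that for every $x\in 2^{\mathbb{N}}$: $S(x)\subseteq x$, $S(x)\in\mathcal{C}$, and $S(x)$ is infinite whenever $x$ is infinite. *)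

theory Defs
  imports "HOL-Analysis.Analysis"
begin

text \<open>Subsets of nat are identified with points of the Cantor space 2^N,
  modelled as the type nat \<Rightarrow> bool with its library product topology
  (bool carries the discrete topology).\<close>

definition to_cantor :: "nat set \<Rightarrow> (nat \<Rightarrow> bool)" where
  "to_cantor x = (\<lambda>n. n \<in> x)"

definition is_ideal :: "nat set set \<Rightarrow> bool" where
  "is_ideal I \<longleftrightarrow> (\<forall>x\<in>I. \<forall>y. y \<subseteq> x \<longrightarrow> y \<in> I) \<and> (\<forall>x\<in>I. \<forall>y\<in>I. x \<union> y \<in> I)"

definition is_F_sigma_family :: "nat set set \<Rightarrow> bool" where
  "is_F_sigma_family C \<longleftrightarrow> fsigma_in (euclidean :: (nat \<Rightarrow> bool) topology) (to_cantor ` C)"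

definition tall :: "nat set set \<Rightarrow> bool" where
  "tall C \<longleftrightarrow> (\<forall>x. infinite x \<longrightarrow> (\<exists>y. y \<subseteq> x \<and> infinite y \<and> y \<in> C))"

definition borel_selector :: "nat set set \<Rightarrow> (nat set \<Rightarrow> nat set) \<Rightarrow> bool" where
  "borel_selector C S \<longleftrightarrow>
     (\<lambda>f. to_cantor (S {n. f n})) \<in> borel_measurable (borel :: (nat \<Rightarrow> bool) measure) \<and>
     (\<forall>x. S x \<subseteq> x \<and> S x \<in> C \<and> (infinite x \<longrightarrow> infinite (S x)))"

end

theory Submission
  imports Defs "HOL-Library.Ramsey" "HOL-Library.Sublist"
begin

text \<open>
  Identify natural numbers with finite sequences of natural numbers. Every infinite set of such
  sequences contains an infinite antichain or an infinite set of initial segments of one branch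
  \<open>z\<close>. The ideal is generated by the antichains and, for two closed relations \<open>R\<close> whose
  domains cover the Baire space, by the sets of initial segments of a branch \<open>z\<close> that are so
  sparse that their enumeration dominates a \<open>w\<close> with \<open>(z, w) \<in> R\<close>. Domination makes these
  families hereditary and, by Koenig's lemma, closed; the covering makes the ideal tall.

  Applied to the set of all initial segments of \<open>z\<close>, a selector must return a set that reveals
  one of the two domains containing \<open>z\<close>, so a Borel selector yields a Borel set that separates
  the complements of the domains. To rule this out, let \<open>z\<close> code two trees and let the two
  relations say that \<open>w\<close> is a strategy for one of two players who climb through the trees
  simultaneously and try not to fall out first. If just one of the trees has a branch then only
  one of the players has such a strategy, and for any Borel set \<open>D\<close> one can diagonally choose
  \<open>z\<close> so that its trees have branches according to whether \<open>z \<in> D\<close>.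
\<close>

section \<open>Closed sets in spaces of sequences\<close>

lemma open_cylinder:
  fixes f :: "'i \<Rightarrow> 'a::discrete_topology"
  assumes "finite F"
  shows "open {g. \<forall>i\<in>F. g i = f i}"
proof -
  have "open ((\<lambda>g::'i \<Rightarrow> 'a. g i) -` {f i})" for i
    by (rule open_vimage) (auto simp: open_discrete)
  hence "open (\<Inter>i\<in>F. (\<lambda>g::'i \<Rightarrow> 'a. g i) -` {f i})"
    using assms by (intro open_INT) auto
  also have "(\<Inter>i\<in>F. (\<lambda>g::'i \<Rightarrow> 'a. g i) -` {f i}) = {g. \<forall>i\<in>F. g i = f i}"
    by auto
  finally show ?thesis .
qed

lemma open_contains_cylinder:
  fixes f :: "nat \<Rightarrow> 'a::topological_space"
  assumes "open U" "f \<in> U"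
  obtains N where "\<And>g. (\<And>i. i < N \<Longrightarrow> g i = f i) \<Longrightarrow> g \<in> U"
proof -
  have "openin (product_topology (\<lambda>i. euclidean) UNIV) U"
    using assms(1) by (simp add: euclidean_product_topology)
  from product_topology_open_contains_basis[OF this assms(2)]
  obtain X where X: "f \<in> (\<Pi>\<^sub>E i\<in>UNIV. X i)" "finite {i. X i \<noteq> UNIV}" "(\<Pi>\<^sub>E i\<in>UNIV. X i) \<subseteq> U"
    by auto
  obtain N where N: "\<And>i. X i \<noteq> UNIV \<Longrightarrow> i < N"
    using finite_nat_set_iff_bounded X(2) by auto
  show ?thesis
  proof (rule that)
    fix g assume g: "\<And>i. i < N \<Longrightarrow> g i = f i"
    have "g i \<in> X i" for i
      using N[of i] g[of i] X(1) by (cases "X i = UNIV") (auto simp: PiE_iff)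
    thus "g \<in> U" using X(3) by auto
  qed
qed

lemma closed_seqI:
  fixes C :: "('i \<Rightarrow> 'a::discrete_topology) set"
  assumes "\<And>f. (\<And>F. finite F \<Longrightarrow> \<exists>g\<in>C. \<forall>i\<in>F. g i = f i) \<Longrightarrow> f \<in> C"
  shows "closed C"
  unfolding closed_def
proof (subst open_subopen, intro ballI)
  fix f assume "f \<in> - C"
  then obtain F where F: "finite F" "\<not> (\<exists>g\<in>C. \<forall>i\<in>F. g i = f i)"
    using assms by blast
  show "\<exists>T. open T \<and> f \<in> T \<and> T \<subseteq> - C"
    by (rule exI[of _ "{g. \<forall>i\<in>F. g i = f i}"]) (use F open_cylinder in auto)
qed

lemma closed_cylinder:
  fixes f :: "'i \<Rightarrow> 'a::discrete_topology"
  shows "closed {g. \<forall>i\<in>F. g i = f i}"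
proof (rule closed_seqI)
  fix h :: "'i \<Rightarrow> 'a"
  assume lim: "\<And>A. finite A \<Longrightarrow> \<exists>g\<in>{g. \<forall>i\<in>F. g i = f i}. \<forall>i\<in>A. g i = h i"
  have "h i = f i" if "i \<in> F" for i
    using lim[of "{i}"] that by auto
  thus "h \<in> {g. \<forall>i\<in>F. g i = f i}" by simp
qed

lemma closed_seq_prodI:
  fixes R :: "(('i \<Rightarrow> 'a::discrete_topology) \<times> ('j \<Rightarrow> 'b::discrete_topology)) set"
  assumes "\<And>z w. (\<And>F G. finite F \<Longrightarrow> finite G \<Longrightarrow>
      \<exists>(z', w')\<in>R. (\<forall>i\<in>F. z' i = z i) \<and> (\<forall>i\<in>G. w' i = w i)) \<Longrightarrow> (z, w) \<in> R"
  shows "closed R"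
  unfolding closed_def
proof (subst open_subopen, intro ballI)
  fix p assume p: "p \<in> - R"
  obtain z w where zw: "p = (z, w)" by fastforce
  have "\<not> (\<forall>F G. finite F \<longrightarrow> finite G \<longrightarrow>
      (\<exists>(z', w')\<in>R. (\<forall>i\<in>F. z' i = z i) \<and> (\<forall>i\<in>G. w' i = w i)))"
  proof
    assume "\<forall>F G. finite F \<longrightarrow> finite G \<longrightarrow>
      (\<exists>(z', w')\<in>R. (\<forall>i\<in>F. z' i = z i) \<and> (\<forall>i\<in>G. w' i = w i))"
    hence "(z, w) \<in> R" by (intro assms) blast
    thus False using p zw by simp
  qed
  then obtain F G where F: "finite F" "finite G"
      "\<not> (\<exists>(z', w')\<in>R. (\<forall>i\<in>F. z' i = z i) \<and> (\<forall>i\<in>G. w' i = w i))"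
    by auto
  let ?T = "{g. \<forall>i\<in>F. g i = z i} \<times> {g. \<forall>i\<in>G. g i = w i}"
  have "open ?T" by (intro open_Times open_cylinder F)
  moreover have "p \<in> ?T" by (simp add: zw)
  moreover have "?T \<subseteq> - R" using F(3) by auto
  ultimately show "\<exists>T. open T \<and> p \<in> T \<and> T \<subseteq> - R" by blast
qed

lemma closed_seq_prodD:
  fixes R :: "((nat \<Rightarrow> 'a::topological_space) \<times> (nat \<Rightarrow> 'b::topological_space)) set"
  assumes "closed R"
    and lim: "\<And>N. \<exists>(z', w')\<in>R. (\<forall>i<N. z' i = z i) \<and> (\<forall>i<N. w' i = w i)"
  shows "(z, w) \<in> R"
proof (rule ccontr)
  assume "(z, w) \<notin> R"
  hence "(z, w) \<in> - R" "open (- R)" using assms(1) by auto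
  then obtain A B where AB: "open A" "open B" "(z, w) \<in> A \<times> B" "A \<times> B \<subseteq> - R"
    by (metis open_prod_elim)
  obtain M where M: "\<And>g. (\<And>i. i < M \<Longrightarrow> g i = z i) \<Longrightarrow> g \<in> A"
    using open_contains_cylinder[of A z] AB by auto
  obtain N where N: "\<And>g. (\<And>i. i < N \<Longrightarrow> g i = w i) \<Longrightarrow> g \<in> B"
    using open_contains_cylinder[of B w] AB by auto
  from lim[of "max M N"] obtain z' w' where
    "(z', w') \<in> R" "\<forall>i<max M N. z' i = z i" "\<forall>i<max M N. w' i = w i" by auto
  with M[of z'] N[of w'] AB(4) show False by auto
qed

lemma continuous_on_clopen:
  assumes "open C" "closed C"
  shows "continuous_on UNIV (\<lambda>x. x \<in> C)"
  unfolding continuous_on_open_vimage[OF open_UNIV]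
proof (intro allI impI)
  fix B :: "bool set"
  have "(\<lambda>x. x \<in> C) -` B \<inter> UNIV = (if True \<in> B then C else {}) \<union> (if False \<in> B then - C else {})"
  proof (rule set_eqI)
    fix x
    show "x \<in> (\<lambda>x. x \<in> C) -` B \<inter> UNIV \<longleftrightarrow>
        x \<in> (if True \<in> B then C else {}) \<union> (if False \<in> B then - C else {})"
      by (cases "x \<in> C") simp_all
  qed
  thus "open ((\<lambda>x. x \<in> C) -` B \<inter> UNIV)" using assms by auto
qed

lemma compact_cantor: "compact (UNIV :: ('i \<Rightarrow> bool) set)"
proof -
  have "compact_space (product_topology (\<lambda>i::'i. euclidean :: bool topology) UNIV)"
    by (subst compact_space_product_topology)
       (auto simp: compact_space_def intro!: finite_imp_compact)
  thus ?thesis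
    by (simp add: euclidean_product_topology compact_space_def)
qed

text \<open>Lets \<open>closed_unions\<close> treat closed families as compact ones, whose
  continuous images are closed again.\<close>

lemma compact_cantor_iff_closed: "compact C \<longleftrightarrow> closed C" for C :: "('i \<Rightarrow> bool) set"
proof
  assume "compact C"
  moreover have "Hausdorff_space (euclidean :: bool topology)"
    unfolding Hausdorff_space_def disjnt_def open_openin[symmetric] by (intro allI impI hausdorff) (elim conjE)
  hence "Hausdorff_space (product_topology (\<lambda>i::'i. euclidean :: bool topology) UNIV)"
    by (simp add: Hausdorff_space_product_topology)
  ultimately show "closed C"
    using compactin_imp_closedin[of "product_topology (\<lambda>i::'i. euclidean :: bool topology) UNIV" C]
    by (simp add: euclidean_product_topology)
next
  assume "closed C"
  thus "compact C" using compact_Int_closed[OF compact_cantor] by auto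
qed

text \<open>By Tychonoff. This is the form in which Koenig's lemma enters
  \<open>coded_branch\<close>.\<close>

lemma compact_bounded_seqs: "compact {w :: nat \<Rightarrow> nat. \<forall>j. w j \<le> B j}"
proof -
  have "compactin (product_topology (\<lambda>i::nat. euclidean :: nat topology) UNIV) (\<Pi>\<^sub>E j\<in>UNIV. {..B j})"
    by (subst compactin_PiE) (auto intro!: finite_imp_compact)
  moreover have "(\<Pi>\<^sub>E j\<in>UNIV. {..B j}) = {w :: nat \<Rightarrow> nat. \<forall>j. w j \<le> B j}"
    by (auto simp: PiE_iff)
  ultimately show ?thesis by (simp add: euclidean_product_topology)
qed

section \<open>Borel sets are bi-analytic\<close>

definition analytic_set :: "(nat \<Rightarrow> nat) set \<Rightarrow> bool" where
  "analytic_set E \<longleftrightarrow> (\<exists>R :: ((nat \<Rightarrow> nat) \<times> (nat \<Rightarrow> nat)) set. closed R \<and> E = fst ` R)"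

lemma closed_analytic: "closed E \<Longrightarrow> analytic_set E"
  unfolding analytic_set_def
  by (rule exI[of _ "E \<times> UNIV"]) (simp add: closed_Times)

text \<open>The first entry of a witness names an index \<open>n\<close>; its tail is a witness for
  \<open>E n\<close>.\<close>

lemma analytic_set_UN:
  assumes "\<And>n::nat. analytic_set (E n)"
  shows "analytic_set (\<Union>n. E n)"
proof -
  from assms have "\<forall>n. \<exists>R :: ((nat \<Rightarrow> nat) \<times> (nat \<Rightarrow> nat)) set. closed R \<and> E n = fst ` R"
    unfolding analytic_set_def by blast
  from choice[OF this] obtain R :: "nat \<Rightarrow> ((nat \<Rightarrow> nat) \<times> (nat \<Rightarrow> nat)) set"
    where R: "\<And>n. closed (R n)" "\<And>n. E n = fst ` R n" by auto
  \<comment> \<open>The condition "if the first entry is \<open>n\<close>, then the tail works for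
    \<open>R n\<close>" is a union of two closed sets, so quantifying over all \<open>n\<close>
    keeps it closed.\<close>
  define Q where "Q = (\<Inter>n. {p. snd p 0 \<noteq> n} \<union> (\<lambda>p. (fst p, snd p \<circ> Suc)) -` R n)"
  have "closed ({p :: (nat \<Rightarrow> nat) \<times> (nat \<Rightarrow> nat). snd p 0 \<noteq> n} \<union> (\<lambda>p. (fst p, snd p \<circ> Suc)) -` R n)" for n
  proof (intro closed_Un closed_vimage R)
    have "closed ((\<lambda>p :: (nat \<Rightarrow> nat) \<times> (nat \<Rightarrow> nat). snd p 0) -` (- {n}))"
      by (intro closed_vimage continuous_intros continuous_on_product_then_coordinatewise)
        (simp add: closed_def open_discrete)
    thus "closed {p :: (nat \<Rightarrow> nat) \<times> (nat \<Rightarrow> nat). snd p 0 \<noteq> n}"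
      by (simp add: vimage_def)
    show "continuous_on UNIV (\<lambda>p :: (nat \<Rightarrow> nat) \<times> (nat \<Rightarrow> nat). (fst p, snd p \<circ> Suc))"
      unfolding o_def
      by (intro continuous_intros continuous_on_coordinatewise_then_product
          continuous_on_product_then_coordinatewise)
  qed
  hence "closed Q" unfolding Q_def by auto
  moreover have "(\<Union>n. E n) = fst ` Q"
  proof (intro equalityI subsetI)
    fix z assume "z \<in> (\<Union>n. E n)"
    then obtain n w where w: "(z, w) \<in> R n" using R(2) by auto
    have "(z, case_nat n w) \<in> Q" using w by (auto simp: Q_def o_def)
    thus "z \<in> fst ` Q" by force
  next
    fix z assume "z \<in> fst ` Q"
    then obtain w where "(z, w) \<in> Q" by auto
    hence "(z, w \<circ> Suc) \<in> R (w 0)" by (auto simp: Q_def)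
    thus "z \<in> (\<Union>n. E n)" using R(2) by force
  qed
  ultimately show ?thesis unfolding analytic_set_def by blast
qed

text \<open>One witness interleaves witnesses for all \<open>E n\<close>: the one for
  \<open>n\<close> sits at the positions \<open>prod_encode (n, i)\<close>.\<close>

lemma analytic_set_INT:
  assumes "\<And>n::nat. analytic_set (E n)"
  shows "analytic_set (\<Inter>n. E n)"
proof -
  from assms have "\<forall>n. \<exists>R :: ((nat \<Rightarrow> nat) \<times> (nat \<Rightarrow> nat)) set. closed R \<and> E n = fst ` R"
    unfolding analytic_set_def by blast
  from choice[OF this] obtain R :: "nat \<Rightarrow> ((nat \<Rightarrow> nat) \<times> (nat \<Rightarrow> nat)) set"
    where R: "\<And>n. closed (R n)" "\<And>n. E n = fst ` R n" by auto
  define Q where "Q = (\<Inter>n. (\<lambda>p. (fst p, \<lambda>i. snd p (prod_encode (n, i)))) -` R n)"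
  have "closed ((\<lambda>p :: (nat \<Rightarrow> nat) \<times> (nat \<Rightarrow> nat). (fst p, \<lambda>i. snd p (prod_encode (n, i)))) -` R n)" for n
    by (intro closed_vimage R continuous_intros continuous_on_coordinatewise_then_product
          continuous_on_product_then_coordinatewise)
  hence "closed Q" unfolding Q_def by auto
  moreover have "(\<Inter>n. E n) = fst ` Q"
  proof (intro equalityI subsetI)
    fix z assume "z \<in> (\<Inter>n. E n)"
    hence "z \<in> fst ` R n" for n using R(2) by auto
    hence "\<forall>n. \<exists>w. (z, w) \<in> R n" by fastforce
    then obtain w where w: "\<And>n. (z, w n) \<in> R n" by metis
    have "(z, \<lambda>k. case prod_decode k of (n, i) \<Rightarrow> w n i) \<in> Q" using w by (auto simp: Q_def)
    thus "z \<in> fst ` Q" by force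
  next
    fix z assume "z \<in> fst ` Q"
    then obtain w where "(z, w) \<in> Q" by auto
    hence "(z, \<lambda>i. w (prod_encode (n, i))) \<in> R n" for n by (auto simp: Q_def)
    thus "z \<in> (\<Inter>n. E n)" using R(2) by force
  qed
  ultimately show ?thesis unfolding analytic_set_def by blast
qed

section \<open>Initial segments and tree representations of analytic sets\<close>

definition pre :: "(nat \<Rightarrow> 'a) \<Rightarrow> nat \<Rightarrow> 'a list" where
  "pre z n = map z [0..<n]"

lemma length_pre [simp]: "length (pre z n) = n"
  by (simp add: pre_def)

lemma nth_pre [simp]: "i < n \<Longrightarrow> pre z n ! i = z i"
  by (simp add: pre_def)

lemma pre_eq_list_iff: "pre z (length s) = s \<longleftrightarrow> (\<forall>i<length s. z i = s ! i)"
  by (simp add: list_eq_iff_nth_eq)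

lemma pre_eq_iff: "pre z n = pre w n \<longleftrightarrow> (\<forall>i<n. z i = w i)"
  by (simp add: list_eq_iff_nth_eq)

lemma take_pre: "take k (pre z n) = pre z (min k n)"
  by (rule nth_equalityI) simp_all

text \<open>The cylinders are closed, are indexed by coded lists and hence countably many, and those
  inside \<open>U\<close> cover \<open>U\<close>.\<close>

lemma open_analytic:
  assumes "open U" shows "analytic_set U"
proof -
  define C where "C n = {z. pre z (length (list_decode n)) = list_decode n}" for n
  have "C n = {z. \<forall>i\<in>{..<length (list_decode n)}. z i = list_decode n ! i}" for n
    unfolding C_def pre_eq_list_iff Ball_def lessThan_iff ..
  hence "closed (C n)" for n
    by (simp only: closed_cylinder)
  hence "analytic_set (if C n \<subseteq> U then C n else {})" for n
    by (simp add: closed_analytic)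
  moreover have "U = (\<Union>n. if C n \<subseteq> U then C n else {})"
  proof (intro equalityI subsetI)
    fix z assume "z \<in> U"
    then obtain N where N: "\<And>g. (\<And>i. i < N \<Longrightarrow> g i = z i) \<Longrightarrow> g \<in> U"
      by (rule open_contains_cylinder[OF assms]) blast
    let ?n = "list_encode (pre z N)"
    have "z \<in> C ?n" "C ?n \<subseteq> U" using N by (auto simp: C_def pre_eq_iff)
    thus "z \<in> (\<Union>n. if C n \<subseteq> U then C n else {})" by (intro UN_I[of ?n]) auto
  qed (auto split: if_splits)
  ultimately show ?thesis using analytic_set_UN[of "\<lambda>n. if C n \<subseteq> U then C n else {}"] by simp
qed

text \<open>Claiming both halves at once makes complements trivial in the induction; the complement
  of a union is an intersection of analytic sets.\<close>

lemma borel_bianalytic: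
  assumes "E \<in> sets borel"
  shows "analytic_set E \<and> analytic_set (- E)"
proof -
  have "E \<in> sigma_sets UNIV {S. open S}" using assms by (simp add: sets_borel)
  thus ?thesis
  proof induction
    case (Basic a)
    thus ?case by (auto intro: open_analytic closed_analytic)
  next
    case Empty
    show ?case by (auto intro: closed_analytic)
  next
    case (Compl a)
    thus ?case by (simp add: Compl_eq_Diff_UNIV double_diff)
  next
    case (Union a)
    thus ?case by (auto intro: analytic_set_UN analytic_set_INT)
  qed
qed

text \<open>Take \<open>P u v\<close> to say that some point of \<open>R\<close> extends
  \<open>(u, v)\<close>. As \<open>R\<close> is closed, a pair all of whose initial segments extend
  into \<open>R\<close> lies in \<open>R\<close>.\<close>

lemma analytic_set_tree:
  assumes "analytic_set E"
  obtains P where "E = {z. \<exists>w::nat \<Rightarrow> nat. \<forall>k. P (pre z k) (pre w k)}"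
proof -
  obtain R :: "((nat \<Rightarrow> nat) \<times> (nat \<Rightarrow> nat)) set" where R: "closed R" "E = fst ` R"
    using assms unfolding analytic_set_def by auto
  define P where "P u v \<longleftrightarrow> (\<exists>(z, w)\<in>R. pre z (length u) = u \<and> pre w (length v) = v)" for u v
  have "E = {z. \<exists>w. \<forall>k. P (pre z k) (pre w k)}"
  proof (intro equalityI subsetI)
    fix z assume "z \<in> {z. \<exists>w. \<forall>k. P (pre z k) (pre w k)}"
    then obtain w where "\<And>k. P (pre z k) (pre w k)" by auto
    hence "\<exists>(z', w')\<in>R. (\<forall>i<k. z' i = z i) \<and> (\<forall>i<k. w' i = w i)" for k
      by (simp add: P_def pre_eq_iff)
    hence "(z, w) \<in> R" by (intro closed_seq_prodD[OF R(1)]) auto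
    thus "z \<in> E" using R(2) by force
  next
    fix z assume "z \<in> E"
    then obtain w where "(z, w) \<in> R" using R(2) by auto
    hence "\<forall>k. P (pre z k) (pre w k)" by (auto simp: P_def)
    thus "z \<in> {z. \<exists>w. \<forall>k. P (pre z k) (pre w k)}" by blast
  qed
  thus ?thesis by (rule that)
qed

section \<open>Two analytic sets covering the Baire space\<close>

text \<open>\<open>z\<close> is read as a table of permitted pairs of finite sequences, with entry 0
  for permitted, and is looked up at its own initial segments. A branch is thus a witness that
  \<open>z\<close> belongs to the analytic set that \<open>z\<close> itself codes, which is the
  self-reference needed for the diagonalisation. The flag \<open>b\<close> selects one of two
  tables.\<close>

definition tree :: "bool \<Rightarrow> (nat \<Rightarrow> nat) \<Rightarrow> nat list set" where
  "tree b z = {s. \<forall>k\<le>length s. z (to_nat (b, pre z k, take k s)) = 0}"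

text \<open>The answers of a player following \<open>f\<close> to the opponent's moves
  \<open>s\<close>. With \<open>b = True\<close> this player moves second and has already seen move
  \<open>i\<close>, hence \<open>Suc i\<close>; with \<open>b = False\<close> only the earlier moves
  are visible.\<close>

definition play :: "bool \<Rightarrow> (nat \<Rightarrow> nat) \<Rightarrow> nat list \<Rightarrow> nat list" where
  "play b f s = map (\<lambda>i. f (list_encode (take (if b then Suc i else i) s))) [0..<length s]"

lemma play_Nil [simp]: "play b f [] = []"
  by (simp add: play_def)

lemma play_snoc:
  "play b f (s @ [a]) = play b f s @ [f (list_encode (if b then s @ [a] else s))]"
proof -
  have "map (\<lambda>i. f (list_encode (take (if b then Suc i else i) (s @ [a])))) [0..<length s] = play b f s"
    unfolding play_def by (intro map_cong refl) auto
  thus ?thesis by (simp add: play_def)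
qed

text \<open>In the game where two players simultaneously climb through the trees \<open>tree True z\<close>
  and \<open>tree False z\<close>, the former moving first, \<open>strat True\<close> collects the strategies with
  which the second player never leaves her tree before the first does;
  \<open>strat False\<close> is the same for the first player.\<close>

definition strat :: "bool \<Rightarrow> ((nat \<Rightarrow> nat) \<times> (nat \<Rightarrow> nat)) set" where
  "strat b = {(z, f). \<forall>s\<in>tree b z. play b f s \<in> tree (\<not> b) z}"

text \<open>The values of \<open>z\<close> below \<open>length s\<close> determine which entries are
  looked up, and these finitely many entries decide membership.\<close>

lemma tree_local:
  obtains F where "finite F" "\<And>z'. (\<forall>i\<in>F. z' i = z i) \<Longrightarrow> s \<in> tree b z' \<longleftrightarrow> s \<in> tree b z"
proof (rule that)
  let ?F = "{..<length s} \<union> (\<lambda>k. to_nat (b, pre z k, take k s)) ` {..length s}"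
  show "finite ?F" by auto
  fix z' assume a: "\<forall>i\<in>?F. z' i = z i"
  have "pre z' k = pre z k" if "k \<le> length s" for k
    using a that by (auto simp: pre_eq_iff)
  thus "s \<in> tree b z' \<longleftrightarrow> s \<in> tree b z"
    using a by (auto simp: tree_def)
qed

text \<open>For each single \<open>s\<close> the condition involves only finitely many values of
  \<open>z\<close> and \<open>f\<close>.\<close>

lemma closed_strat: "closed (strat b)"
proof (rule closed_seq_prodI)
  fix z f :: "nat \<Rightarrow> nat"
  assume lim: "\<And>F G. finite F \<Longrightarrow> finite G \<Longrightarrow>
      \<exists>(z', f')\<in>strat b. (\<forall>i\<in>F. z' i = z i) \<and> (\<forall>i\<in>G. f' i = f i)"
  have "play b f s \<in> tree (\<not> b) z" if s: "s \<in> tree b z" for s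
  proof -
    obtain F where F: "finite F" "\<And>z'. (\<forall>i\<in>F. z' i = z i) \<Longrightarrow> s \<in> tree b z' \<longleftrightarrow> s \<in> tree b z"
      using tree_local by blast
    obtain F' where F': "finite F'" "\<And>z'. (\<forall>i\<in>F'. z' i = z i) \<Longrightarrow>
        play b f s \<in> tree (\<not> b) z' \<longleftrightarrow> play b f s \<in> tree (\<not> b) z"
      using tree_local by blast
    let ?G = "(\<lambda>i. list_encode (take (if b then Suc i else i) s)) ` {..<length s}"
    obtain z' f' where z': "(z', f') \<in> strat b" "\<forall>i\<in>F\<union>F'. z' i = z i" "\<forall>i\<in>?G. f' i = f i"
      using lim[of "F \<union> F'" ?G] F F' by auto
    have "play b f' s = play b f s" using z'(3) by (auto simp: play_def)
    moreover have "play b f' s \<in> tree (\<not> b) z'"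
      using z' s F(2)[of z'] by (auto simp: strat_def)
    ultimately show ?thesis using F'(2)[of z'] z'(2) by auto
  qed
  thus "(z, f) \<in> strat b" by (auto simp: strat_def)
qed

section \<open>Determinacy of the climbing game\<close>

lemma ex_snoc_rec:
  "\<exists>h. h [] = e \<and> (\<forall>s a. h (s @ [a]) = g s (h s) a)"
proof -
  \<comment> \<open>The fold carries the list read so far beside the value, since \<open>g\<close>
    depends on both.\<close>
  define h where "h s = snd (foldl (\<lambda>(s, t) a. (s @ [a], g s t a)) ([], e) s)" for s
  have "fst (foldl (\<lambda>(s, t) a. (s @ [a], g s t a)) ([], e) s) = s" for s
    by (induction s rule: rev_induct) (auto split: prod.split)
  hence eq: "foldl (\<lambda>(s, t) a. (s @ [a], g s t a)) ([], e) s = (s, h s)" for s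
    by (simp add: h_def prod_eq_iff)
  have "h [] = e" by (simp add: h_def)
  moreover have "h (s @ [a]) = g s (h s) a" for s a
    using eq[of "s @ [a]"] eq[of s] by simp
  ultimately
  show ?thesis by blast
qed

lemma tree_take: "s \<in> tree b z \<Longrightarrow> take k s \<in> tree b z"
  by (simp add: tree_def)

text \<open>The second player can keep answering from the position \<open>(s, t)\<close>. The first player's
  strategy in \<open>strat_covers\<close> is to move so that this remains false.\<close>

coinductive survives :: "nat list set \<Rightarrow> nat list set \<Rightarrow> nat list \<Rightarrow> nat list \<Rightarrow> bool"
  for S T where
  "(\<And>a. s @ [a] \<in> S \<Longrightarrow> \<exists>b. t @ [b] \<in> T \<and> survives S T (s @ [a]) (t @ [b])) \<Longrightarrow> survives S T s t"

text \<open>Gale-Stewart determinacy: the second player can preserve \<open>survives\<close> from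
  the root, or else the first player can preserve its negation. If a root is missing, that tree is
  empty and any \<open>f\<close> is a strategy for the opponent.\<close>

lemma strat_covers: "\<exists>b f. (z, f) \<in> strat b"
proof -
  define S T where "S = tree True z" and "T = tree False z"
  have pS: "s @ [a] \<in> S \<Longrightarrow> s \<in> S" and pT: "s @ [a] \<in> T \<Longrightarrow> s \<in> T" for s a
    using tree_take[of "s @ [a]" _ z "length s"] by (auto simp: S_def T_def)
  consider "[] \<notin> S" | "[] \<notin> T" | "[] \<in> S" "[] \<in> T" "survives S T [] []"
    | "[] \<in> S" "[] \<in> T" "\<not> survives S T [] []" by blast
  thus ?thesis
  proof cases
    case 1
    hence "(z, \<lambda>_. 0) \<in> strat True"
      using tree_take[of _ True z 0] by (auto simp: strat_def S_def)
    thus ?thesis by blast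
  next
    case 2
    hence "(z, \<lambda>_. 0) \<in> strat False"
      using tree_take[of _ False z 0] by (auto simp: strat_def T_def)
    thus ?thesis by blast
  next
    case 3
    \<comment> \<open>With the hypotheses inside the existential, the choice function
      \<open>B\<close> is total.\<close>
    have "\<exists>b. survives S T s t \<longrightarrow> s @ [a] \<in> S \<longrightarrow>
        t @ [b] \<in> T \<and> survives S T (s @ [a]) (t @ [b])" for s t a
      by (blast elim: survives.cases)
    then obtain B where B: "\<And>s t a. survives S T s t \<Longrightarrow> s @ [a] \<in> S \<Longrightarrow>
        t @ [B s t a] \<in> T \<and> survives S T (s @ [a]) (t @ [B s t a])"
      by metis
    obtain h where h: "h [] = []" "\<And>s a. h (s @ [a]) = h s @ [B s (h s) a]"
      using ex_snoc_rec[of "[]" "\<lambda>s t a. t @ [B s t a]"] by auto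
    have inv: "s \<in> S \<Longrightarrow> h s \<in> T \<and> survives S T s (h s)" for s
    proof (induction s rule: rev_induct)
      case Nil
      thus ?case using 3 h by simp
    next
      case (snoc a s)
      thus ?case using B[of s "h s" a] pS h(2) by auto
    qed
    \<comment> \<open>The strategy is shown the moves including the current one, so its answer is
      the last entry of the position \<open>h\<close> reached by the second player.\<close>
    define f where "f n = last (h (list_decode n))" for n
    have "play True f s = h s" for s
      by (induction s rule: rev_induct) (auto simp: play_snoc h f_def)
    hence "(z, f) \<in> strat True" using inv by (auto simp: strat_def S_def T_def)
    thus ?thesis by blast
  next
    case 4
    have "\<exists>a. \<not> survives S T s t \<longrightarrow> s @ [a] \<in> S \<and>
        (\<forall>b. t @ [b] \<in> T \<longrightarrow> \<not> survives S T (s @ [a]) (t @ [b]))" for s t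
      using survives.intros[of s S t T] by blast
    then obtain A where A: "\<And>s t. \<not> survives S T s t \<Longrightarrow> s @ [A s t] \<in> S \<and>
        (\<forall>b. t @ [b] \<in> T \<longrightarrow> \<not> survives S T (s @ [A s t]) (t @ [b]))"
      by metis
    obtain h where h: "h [] = []" "\<And>t b. h (t @ [b]) = h t @ [A (h t) t]"
      using ex_snoc_rec[of "[]" "\<lambda>t s b. s @ [A s t]"] by auto
    have inv: "t \<in> T \<Longrightarrow> h t \<in> S \<and> \<not> survives S T (h t) t" for t
    proof (induction t rule: rev_induct)
      case Nil
      thus ?case using 4 h by simp
    next
      case (snoc b t)
      thus ?case using A[of "h t" t] pT h(2) by auto
    qed
    \<comment> \<open>Here only the earlier moves of the opponent are shown, so \<open>f\<close>
      returns the move that extends the position \<open>h t\<close>.\<close>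
    define f where "f n = A (h (list_decode n)) (list_decode n)" for n
    have "play False f t = h t" for t
      by (induction t rule: rev_induct) (auto simp: play_snoc h f_def)
    hence "(z, f) \<in> strat False" using inv by (auto simp: strat_def S_def T_def)
    thus ?thesis by blast
  qed
qed

text \<open>Let \<open>f\<close> play against the infinite run \<open>w\<close>: each answer depends
  only on an initial segment of \<open>w\<close>, so the answers form one sequence, and it never
  leaves the other tree.\<close>

lemma strat_branch:
  assumes "(z, f) \<in> strat b" and "\<And>n. pre w n \<in> tree b z"
  shows "\<exists>w'. \<forall>n. pre w' n \<in> tree (\<not> b) z"
proof -
  let ?w = "\<lambda>i. f (list_encode (pre w (if b then Suc i else i)))"
  have "play b f (pre w n) = pre ?w n" for n
    by (rule nth_equalityI) (simp_all add: play_def take_pre)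
  moreover have "play b f (pre w n) \<in> tree (\<not> b) z" for n
    using assms by (auto simp: strat_def)
  ultimately have "\<forall>n. pre ?w n \<in> tree (\<not> b) z" by simp
  thus ?thesis by (rule exI[of _ ?w])
qed

text \<open>Diagonalisation: a point coding trees for \<open>D\<close> and \<open>- D\<close> is on the wrong side of \<open>D\<close>.\<close>

lemma strat_not_borel_separable:
  assumes "D \<in> sets borel" "D \<subseteq> fst ` strat True" "- fst ` strat False \<subseteq> D"
  shows False
proof -
  obtain P where P: "D = {z. \<exists>w::nat \<Rightarrow> nat. \<forall>k. P (pre z k) (pre w k)}"
    by (rule analytic_set_tree[of D]) (use borel_bianalytic[OF assms(1)] in auto)
  obtain Q where Q: "- D = {z. \<exists>w::nat \<Rightarrow> nat. \<forall>k. Q (pre z k) (pre w k)}"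
    by (rule analytic_set_tree[of "- D"]) (use borel_bianalytic[OF assms(1)] in auto)
  \<comment> \<open>The first table of \<open>c\<close> is the tree predicate of \<open>D\<close>,
    the second that of \<open>- D\<close>.\<close>
  define c :: "nat \<Rightarrow> nat" where
    "c n = (case from_nat n of (b, u, v) \<Rightarrow> if (if b then P u v else Q u v) then 0 else 1)" for n
  have c: "c (to_nat (b, u, v)) = 0 \<longleftrightarrow> (if b then P u v else Q u v)" for b u v
    by (simp add: c_def)
  have "(\<forall>n. pre w n \<in> tree b c) \<longleftrightarrow> (\<forall>k. if b then P (pre c k) (pre w k) else Q (pre c k) (pre w k))"
    for b w
  proof -
    have "pre w n \<in> tree b c \<longleftrightarrow> (\<forall>k\<le>n. if b then P (pre c k) (pre w k) else Q (pre c k) (pre w k))" for n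
      by (auto simp: tree_def c take_pre min_def)
    thus ?thesis by blast
  qed
  hence D: "c \<in> D \<longleftrightarrow> (\<exists>w. \<forall>n. pre w n \<in> tree True c)"
    and nD: "c \<notin> D \<longleftrightarrow> (\<exists>w. \<forall>n. pre w n \<in> tree False c)"
    using P Q Compl_iff[of c D] by simp_all
  show False
  proof (cases "c \<in> D")
    case True
    hence "c \<in> fst ` strat True" using assms(2) by blast
    then obtain f where f: "(c, f) \<in> strat True" by auto
    \<comment> \<open>Answering this branch along \<open>f\<close> gives a branch of
      \<open>tree False c\<close>, which would put \<open>c\<close> outside
      \<open>D\<close>.\<close>
    obtain w where "\<forall>n. pre w n \<in> tree True c" using D True by blast
    hence "\<exists>w'. \<forall>n. pre w' n \<in> tree False c" using strat_branch[OF f, of w] by simp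
    thus False using nD True by blast
  next
    case False
    hence "c \<in> fst ` strat False" using assms(3) by blast
    then obtain f where f: "(c, f) \<in> strat False" by auto
    obtain w where "\<forall>n. pre w n \<in> tree False c" using nD False by blast
    hence "\<exists>w'. \<forall>n. pre w' n \<in> tree True c" using strat_branch[OF f, of w] by simp
    thus False using D False by blast
  qed
qed

section \<open>Generated ideals\<close>

text \<open>Counting the members makes \<open>gen K\<close> a countable union of stages, each a
  continuous image of the product of the previous stage with \<open>K\<close>.\<close>

primrec unions :: "'a set set \<Rightarrow> nat \<Rightarrow> 'a set set" where
  "unions K 0 = {{}}"
| "unions K (Suc n) = {x \<union> y | x y. x \<in> unions K n \<and> y \<in> K}"

definition gen :: "'a set set \<Rightarrow> 'a set set" where
  "gen K = (\<Union>n. unions K n)"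

lemma unions_add:
  "x \<in> unions K m \<Longrightarrow> y \<in> unions K n \<Longrightarrow> x \<union> y \<in> unions K (m + n)"
proof (induction n arbitrary: y)
  case (Suc n)
  then obtain u v where "y = u \<union> v" "u \<in> unions K n" "v \<in> K" by auto
  moreover have "x \<union> u \<in> unions K (m + n)" using Suc calculation by blast
  moreover have "x \<union> y = (x \<union> u) \<union> v" using calculation by blast
  ultimately show ?case by auto
qed auto

lemma gen_Un: "x \<in> gen K \<Longrightarrow> y \<in> gen K \<Longrightarrow> x \<union> y \<in> gen K"
  unfolding gen_def by (metis UN_iff UNIV_I unions_add)

lemma gen_empty: "{} \<in> gen K"
  unfolding gen_def by (rule UN_I[of 0]) auto

lemma subset_gen: "K \<subseteq> gen K"
proof
  fix x assume "x \<in> K"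
  hence "x \<in> unions K (Suc 0)" by auto
  thus "x \<in> gen K" unfolding gen_def by blast
qed

text \<open>Intersect each of the \<open>n\<close> members with \<open>y\<close>.\<close>

lemma unions_subset:
  assumes "\<And>x y. x \<in> K \<Longrightarrow> y \<subseteq> x \<Longrightarrow> y \<in> K"
  shows "x \<in> unions K n \<Longrightarrow> y \<subseteq> x \<Longrightarrow> y \<in> unions K n"
proof (induction n arbitrary: x y)
  case (Suc n)
  then obtain u v where uv: "x = u \<union> v" "u \<in> unions K n" "v \<in> K" by auto
  have "y = (y \<inter> u) \<union> (y \<inter> v)" using Suc.prems uv by auto
  moreover have "y \<inter> u \<in> unions K n" "y \<inter> v \<in> K"
    using Suc.IH uv assms by auto
  ultimately show ?case by auto
qed auto

lemma gen_ideal: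
  assumes "\<And>x y. x \<in> K \<Longrightarrow> y \<subseteq> x \<Longrightarrow> y \<in> K"
  shows "is_ideal (gen K)"
proof -
  have "y \<in> gen K" if x: "x \<in> gen K" and yx: "y \<subseteq> x" for x y
  proof -
    obtain n where "x \<in> unions K n" using x unfolding gen_def by blast
    hence "y \<in> unions K n" using unions_subset[of K x n y] assms yx by blast
    thus ?thesis unfolding gen_def by blast
  qed
  thus ?thesis unfolding is_ideal_def using gen_Un by metis
qed

lemma gen_induct [consumes 1, case_names empty Un]:
  assumes "x \<in> gen K" "P {}" "\<And>x y. x \<in> gen K \<Longrightarrow> P x \<Longrightarrow> y \<in> K \<Longrightarrow> P (x \<union> y)"
  shows "P x"
proof -
  have "x \<in> unions K n \<Longrightarrow> P x" for n x
  proof (induction n arbitrary: x)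
    case (Suc n)
    thus ?case using assms(3) unfolding gen_def by auto
  qed (use assms in auto)
  thus ?thesis using assms(1) unfolding gen_def by auto
qed

lemma to_cantor_image: "to_cantor ` K = {f. Collect f \<in> K}"
proof (rule set_eqI)
  fix f
  have "f = to_cantor (Collect f)" by (simp add: to_cantor_def)
  moreover have "Collect (to_cantor x) = x" for x by (simp add: to_cantor_def)
  ultimately show "f \<in> to_cantor ` K \<longleftrightarrow> f \<in> {f. Collect f \<in> K}"
    by (metis image_iff mem_Collect_eq)
qed

text \<open>Binary union is continuous on the Cantor space, so compactness passes from one stage to
  the next.\<close>

lemma closed_unions:
  assumes "closed (to_cantor ` K)"
  shows "closed (to_cantor ` unions K n)"
proof (induction n)
  case 0
  have "to_cantor ` unions K 0 = {\<lambda>_. False}" by (auto simp: to_cantor_def)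
  thus ?case by (simp flip: compact_cantor_iff_closed)
next
  case (Suc n)
  let ?u = "\<lambda>p :: (nat \<Rightarrow> bool) \<times> (nat \<Rightarrow> bool). \<lambda>i. fst p i \<or> snd p i"
  have "continuous_on UNIV ?u"
  proof (rule continuous_on_coordinatewise_then_product)
    fix i
    let ?A = "(\<lambda>p :: (nat \<Rightarrow> bool) \<times> (nat \<Rightarrow> bool). fst p i) -` {True}"
    let ?B = "(\<lambda>p :: (nat \<Rightarrow> bool) \<times> (nat \<Rightarrow> bool). snd p i) -` {True}"
    have "open ?A" "open ?B"
      by (intro open_vimage open_discrete continuous_intros continuous_on_product_then_coordinatewise)+
    moreover have "closed ?A" "closed ?B"
      by (intro closed_vimage closed_singleton continuous_intros continuous_on_product_then_coordinatewise)+
    ultimately have "continuous_on UNIV (\<lambda>p. p \<in> ?A \<union> ?B)"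
      by (intro continuous_on_clopen open_Un closed_Un)
    moreover have "p \<in> ?A \<union> ?B \<longleftrightarrow> ?u p i" for p by simp
    ultimately show "continuous_on UNIV (\<lambda>p. ?u p i)" by simp
  qed
  moreover have "compact (to_cantor ` unions K n)" "compact (to_cantor ` K)"
    using Suc assms by (simp_all add: compact_cantor_iff_closed)
  ultimately have "compact (?u ` (to_cantor ` unions K n \<times> to_cantor ` K))"
    by (blast intro: compact_continuous_image compact_Times continuous_on_subset)
  moreover have "?u (to_cantor x, to_cantor y) = to_cantor (x \<union> y)" for x y
    by (simp add: to_cantor_def)
  hence "?u ` (to_cantor ` unions K n \<times> to_cantor ` K) = to_cantor ` unions K (Suc n)"
    by (auto simp: image_iff) (metis image_eqI)+
  ultimately show ?case by (simp add: compact_cantor_iff_closed)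
qed

lemma gen_fsigma:
  assumes "closed (to_cantor ` K)"
  shows "is_F_sigma_family (gen K)"
proof -
  have "fsigma_in euclidean (\<Union>(range (\<lambda>n. to_cantor ` unions K n)))"
    by (rule fsigma_in_Union) (auto intro!: closed_imp_fsigma_in closed_unions assms)
  thus ?thesis by (simp add: is_F_sigma_family_def gen_def image_UN)
qed

section \<open>The generators\<close>

lemma closed_cantorI:
  assumes "\<And>x. (\<And>F. finite F \<Longrightarrow> \<exists>y\<in>K. y \<inter> F = x \<inter> F) \<Longrightarrow> x \<in> K"
  shows "closed (to_cantor ` K)"
  unfolding to_cantor_image
proof (rule closed_seqI)
  fix f assume a: "\<And>F. finite F \<Longrightarrow> \<exists>g\<in>{f. Collect f \<in> K}. \<forall>i\<in>F. g i = f i"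
  have "\<exists>y\<in>K. y \<inter> F = Collect f \<inter> F" if fin: "finite F" for F
  proof -
    obtain g where "Collect g \<in> K" "\<forall>i\<in>F. g i = f i" using a[OF fin] by auto
    thus ?thesis by (intro bexI[of _ "Collect g"]) auto
  qed
  thus "f \<in> {f. Collect f \<in> K}" using assms[of "Collect f"] by auto
qed

definition antichains :: "nat set set" where
  "antichains = {y. \<forall>s t. list_encode s \<in> y \<longrightarrow> list_encode t \<in> y \<longrightarrow> prefix s t \<longrightarrow> s = t}"

text \<open>An infinite chain of initial segments of \<open>z\<close> is in \<open>coded R\<close> iff its sequence of lengths
  dominates some \<open>w\<close> with \<open>(z, w) \<in> R\<close>. Domination, expressed by the cardinalities below, passes
  to subsets, and asking only for approximations along the chain makes the family closed.\<close>

definition coded :: "((nat \<Rightarrow> nat) \<times> (nat \<Rightarrow> nat)) set \<Rightarrow> nat set set" where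
  "coded R = {y. \<forall>s. list_encode s \<in> y \<longrightarrow> (\<exists>z w. (z, w) \<in> R \<and> pre z (length s) = s \<and>
     (\<forall>j. card {m. m < length s \<and> m < w j \<and> list_encode (take m s) \<in> y} \<le> j))}"

lemma antichains_subset: "x \<in> antichains \<Longrightarrow> y \<subseteq> x \<Longrightarrow> y \<in> antichains"
  by (auto simp: antichains_def)

lemma coded_subset:
  assumes "x \<in> coded R" "y \<subseteq> x"
  shows "y \<in> coded R"
  unfolding coded_def
proof (intro CollectI allI impI)
  fix s assume "list_encode s \<in> y"
  hence "list_encode s \<in> x" using assms(2) by blast
  then obtain z w where zw: "(z, w) \<in> R" "pre z (length s) = s"
      "\<forall>j. card {m. m < length s \<and> m < w j \<and> list_encode (take m s) \<in> x} \<le> j"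
    using assms(1) unfolding coded_def by blast
  have "card {m. m < length s \<and> m < w j \<and> list_encode (take m s) \<in> y}
      \<le> card {m. m < length s \<and> m < w j \<and> list_encode (take m s) \<in> x}" for j
    using assms(2) by (intro card_mono) auto
  with zw show "\<exists>z w. (z, w) \<in> R \<and> pre z (length s) = s \<and>
     (\<forall>j. card {m. m < length s \<and> m < w j \<and> list_encode (take m s) \<in> y} \<le> j)"
    by (meson le_trans)
qed

lemma closed_antichains: "closed (to_cantor ` antichains)"
proof (rule closed_cantorI)
  fix x assume a: "\<And>F. finite F \<Longrightarrow> \<exists>y\<in>antichains. y \<inter> F = x \<inter> F"
  show "x \<in> antichains"
    unfolding antichains_def
  proof (intro CollectI allI impI)
    fix s t assume st: "list_encode s \<in> x" "list_encode t \<in> x" "prefix s t"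
    obtain y where "y \<in> antichains" "y \<inter> {list_encode s, list_encode t} = x \<inter> {list_encode s, list_encode t}"
      using a[of "{list_encode s, list_encode t}"] by auto
    thus "s = t" using st unfolding antichains_def by blast
  qed
qed

text \<open>The condition at a node \<open>s\<close> mentions only the finitely many initial
  segments of \<open>s\<close>, so a member agreeing with \<open>x\<close> on them supplies the
  witnesses for \<open>x\<close>.\<close>

lemma closed_coded: "closed (to_cantor ` coded R)"
proof (rule closed_cantorI)
  fix x assume a: "\<And>F. finite F \<Longrightarrow> \<exists>y\<in>coded R. y \<inter> F = x \<inter> F"
  show "x \<in> coded R"
    unfolding coded_def
  proof (intro CollectI allI impI)
    fix s assume s: "list_encode s \<in> x"
    let ?F = "(\<lambda>m. list_encode (take m s)) ` {..length s}"
    obtain y where y: "y \<in> coded R" "y \<inter> ?F = x \<inter> ?F" using a[of ?F] by auto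
    have eq: "list_encode (take m s) \<in> y \<longleftrightarrow> list_encode (take m s) \<in> x" if "m \<le> length s" for m
      using y(2) that by blast
    have set_eq: "{m. m < length s \<and> m < k \<and> list_encode (take m s) \<in> y} =
        {m. m < length s \<and> m < k \<and> list_encode (take m s) \<in> x}" for k
      using eq by auto
    have "list_encode s \<in> y" using s eq[of "length s"] by simp
    hence "\<exists>z w. (z, w) \<in> R \<and> pre z (length s) = s \<and>
        (\<forall>j. card {m. m < length s \<and> m < w j \<and> list_encode (take m s) \<in> y} \<le> j)"
      using y(1) unfolding coded_def by blast
    thus "\<exists>z w. (z, w) \<in> R \<and> pre z (length s) = s \<and>
        (\<forall>j. card {m. m < length s \<and> m < w j \<and> list_encode (take m s) \<in> x} \<le> j)"
      unfolding set_eq .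
  qed
qed

section \<open>Generators inside a single branch\<close>

definition branch_set :: "(nat \<Rightarrow> nat) \<Rightarrow> nat set" where
  "branch_set z = range (\<lambda>n. list_encode (pre z n))"

lemma node_in_branch_set: "list_encode s \<in> branch_set z \<longleftrightarrow> s = pre z (length s)"
proof
  assume "list_encode s \<in> branch_set z"
  thus "s = pre z (length s)" by (auto simp: branch_set_def list_encode_eq)
next
  assume "s = pre z (length s)"
  thus "list_encode s \<in> branch_set z" unfolding branch_set_def by (metis rangeI)
qed

lemma inj_node: "inj (\<lambda>n. list_encode (pre z n))"
  by (rule injI) (metis length_pre list_encode_eq)

lemma infinite_levels:
  assumes "y \<subseteq> branch_set z" "infinite y"
  shows "infinite {n. list_encode (pre z n) \<in> y}"
proof
  assume "finite {n. list_encode (pre z n) \<in> y}"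
  moreover have "y = (\<lambda>n. list_encode (pre z n)) ` {n. list_encode (pre z n) \<in> y}"
    using assms(1) by (auto simp: branch_set_def)
  ultimately show False using assms(2) by (metis finite_imageI)
qed

text \<open>The nodes of \<open>y\<close> give pairs in \<open>R\<close> approximating
  \<open>z\<close>. As \<open>y\<close> has infinitely many levels, the counting condition bounds
  each coordinate of their second components, so these accumulate at some \<open>w\<close>, and
  \<open>(z, w) \<in> R\<close> because \<open>R\<close> is closed.\<close>

lemma coded_branch:
  assumes "closed R" "y \<in> coded R" "y \<subseteq> branch_set z" "infinite y"
  shows "z \<in> fst ` R"
proof -
  define L where "L = {n. list_encode (pre z n) \<in> y}"
  have L: "infinite L" using infinite_levels assms unfolding L_def by blast
  \<comment> \<open>More than \<open>j\<close> levels of \<open>y\<close> lie below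
    \<open>B j\<close>; a witness with \<open>w j > B j\<close> at a node of length at least
    \<open>B j\<close> would count them all.\<close>
  have "\<exists>B. card {m. m < B \<and> m \<in> L} > j" for j
  proof -
    obtain A where A: "finite A" "card A = Suc j" "A \<subseteq> L" using infinite_arbitrarily_large[OF L] by blast
    obtain B where "\<forall>m\<in>A. m < B" using A(1) finite_nat_set_iff_bounded by auto
    hence "card A \<le> card {m. m < B \<and> m \<in> L}" using A by (intro card_mono) auto
    thus ?thesis using A by (metis Suc_le_eq)
  qed
  then obtain B where B: "\<And>j. card {m. m < B j \<and> m \<in> L} > j" by metis
  have "\<exists>n. n \<ge> k \<and> n \<in> L" for k using L infinite_nat_iff_unbounded_le by blast
  then obtain l where l: "\<And>k. l k \<ge> k \<and> l k \<in> L" by metis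
  have "\<exists>z' w. (z', w) \<in> R \<and> (\<forall>i<k. z' i = z i) \<and> (\<forall>j. B j \<le> k \<longrightarrow> w j \<le> B j)" for k
  proof -
    have "list_encode (pre z (l k)) \<in> y" using l[of k] by (simp add: L_def)
    hence "\<exists>z' w. (z', w) \<in> R \<and> pre z' (length (pre z (l k))) = pre z (l k) \<and>
        (\<forall>j. card {m. m < length (pre z (l k)) \<and> m < w j \<and> list_encode (take m (pre z (l k))) \<in> y} \<le> j)"
      using assms(2) unfolding coded_def by blast
    then obtain z' w where zw: "(z', w) \<in> R" "pre z' (l k) = pre z (l k)"
        "\<And>j. card {m. m < l k \<and> m < w j \<and> list_encode (take m (pre z (l k))) \<in> y} \<le> j"
      unfolding length_pre by blast
    have "w j \<le> B j" if "B j \<le> k" for j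
    proof (rule ccontr)
      assume "\<not> w j \<le> B j"
      hence "{m. m < B j \<and> m \<in> L} \<subseteq> {m. m < l k \<and> m < w j \<and> list_encode (take m (pre z (l k))) \<in> y}"
        using l[of k] that by (auto simp: L_def take_pre)
      hence "card {m. m < B j \<and> m \<in> L} \<le> card {m. m < l k \<and> m < w j \<and> list_encode (take m (pre z (l k))) \<in> y}"
        by (intro card_mono) auto
      thus False using B[of j] zw(3)[of j] by linarith
    qed
    moreover have "\<forall>i<k. z' i = z i" using zw(2) l[of k] by (auto simp: pre_eq_iff)
    ultimately show ?thesis using zw(1) by blast
  qed
  then obtain Z W where ZW: "\<And>k. (Z k, W k) \<in> R" "\<And>k i. i < k \<Longrightarrow> Z k i = z i"
      "\<And>k j. B j \<le> k \<Longrightarrow> W k j \<le> B j"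
    by metis
  \<comment> \<open>Coordinate \<open>j\<close> of \<open>W k\<close> is bounded only once
    \<open>B j \<le> k\<close>; truncation puts every term into the compact set and changes no
    coordinate from that stage on.\<close>
  define V where "V k = (\<lambda>j. min (W k j) (B j))" for k
  have "seq_compact {w :: nat \<Rightarrow> nat. \<forall>j. w j \<le> B j}"
    using compact_bounded_seqs compact_imp_seq_compact by blast
  moreover have "\<forall>k. V k \<in> {w. \<forall>j. w j \<le> B j}" by (auto simp: V_def)
  ultimately obtain w r where r: "strict_mono r" "(V \<circ> r) \<longlonglongrightarrow> w"
    unfolding seq_compact_def by blast
  have "(z, w) \<in> R"
  proof (rule closed_seq_prodD[OF assms(1)])
    fix N
    have "eventually (\<lambda>k. (V \<circ> r) k \<in> {g. \<forall>i\<in>{..<N}. g i = w i}) sequentially"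
      by (rule topological_tendstoD[OF r(2) open_cylinder]) auto
    \<comment> \<open>Beyond this stage the truncation is void on the coordinates below
      \<open>N\<close>, and \<open>Z\<close> agrees with \<open>z\<close> there.\<close>
    moreover have "eventually (\<lambda>k. k \<ge> Max (insert N (B ` {..<N}))) sequentially"
      by (rule eventually_ge_at_top)
    ultimately have "eventually (\<lambda>k. (\<forall>i<N. V (r k) i = w i) \<and> k \<ge> Max (insert N (B ` {..<N}))) sequentially"
      by eventually_elim auto
    then obtain k where k: "\<forall>i<N. V (r k) i = w i" "k \<ge> Max (insert N (B ` {..<N}))"
      using eventually_happens by fastforce
    have rk: "r k \<ge> k" using r(1) by (simp add: seq_suble)
    have le: "x \<le> r k" if "x \<in> insert N (B ` {..<N})" for x
    proof -
      have "x \<le> Max (insert N (B ` {..<N}))" using that by (intro Max_ge) auto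
      thus ?thesis using k(2) rk by (meson le_trans)
    qed
    have "\<forall>i<N. Z (r k) i = z i" using ZW(2)[of _ "r k"] le[of N] by simp
    moreover have "W (r k) i = w i" if "i < N" for i
    proof -
      have "W (r k) i \<le> B i" using ZW(3)[of i "r k"] le[of "B i"] that by simp
      moreover have "min (W (r k) i) (B i) = w i" using k(1) that by (simp add: V_def)
      ultimately show ?thesis by simp
    qed
    ultimately show "\<exists>(z', w')\<in>R. (\<forall>i<N. z' i = z i) \<and> (\<forall>i<N. w' i = w i)"
      using ZW(1) by blast
  qed
  thus ?thesis by force
qed

text \<open>Choose the element of \<open>Y\<close> with index \<open>i\<close> to be at least
  \<open>w j\<close> for all \<open>j \<le> i\<close>; then only those with index less than
  \<open>j\<close> can lie below \<open>w j\<close>.\<close>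

lemma thin_subset:
  fixes w :: "nat \<Rightarrow> nat"
  assumes "infinite X"
  obtains Y where "Y \<subseteq> X" "infinite Y" "\<And>j. finite {m \<in> Y. m < w j} \<and> card {m \<in> Y. m < w j} \<le> j"
proof -
  \<comment> \<open>The sum bounds all earlier values of \<open>w\<close> at once, and the summand
    \<open>j\<close> makes \<open>g\<close> strictly increasing.\<close>
  define g where "g j = j + (\<Sum>i\<le>j. w i)" for j
  have g: "strict_mono g" by (rule strict_monoI_Suc) (simp add: g_def)
  have e: "strict_mono (enumerate X)" using assms by (rule strict_mono_enumerate)
  have w: "w j \<le> enumerate X (g i)" if "j \<le> i" for i j
  proof -
    have "w j \<le> g i" using that member_le_sum[of j "{..i}" w] by (simp add: g_def)
    also have "\<dots> \<le> enumerate X (g i)" using assms by (rule le_enumerate)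
    finally show ?thesis .
  qed
  let ?h = "\<lambda>j. enumerate X (g j)"
  show ?thesis
  proof (rule that[of "range ?h"])
    show "range ?h \<subseteq> X" using assms by (auto intro: enumerate_in_set)
    have "inj ?h" using strict_mono_imp_inj_on[OF strict_mono_o[OF e g]] by (simp add: o_def)
    thus "infinite (range ?h)" by (simp add: finite_image_iff)
    fix j
    have sub: "{m \<in> range ?h. m < w j} \<subseteq> ?h ` {..<j}"
    proof
      fix m assume "m \<in> {m \<in> range ?h. m < w j}"
      then obtain i where i: "m = ?h i" "?h i < w j" by auto
      hence "i < j" using w[of j i] by (meson not_le)
      thus "m \<in> ?h ` {..<j}" using i(1) by blast
    qed
    have "card (?h ` {..<j}) \<le> j" using card_image_le[of "{..<j}" ?h] by simp
    thus "finite {m \<in> range ?h. m < w j} \<and> card {m \<in> range ?h. m < w j} \<le> j"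
      using card_mono[OF _ sub] finite_subset[OF sub] by simp
  qed
qed

text \<open>Thin out the levels of \<open>x\<close> along \<open>w\<close>; the same pair
  \<open>(z, w)\<close> then serves at every remaining node.\<close>

lemma coded_thin:
  assumes "(z, w) \<in> R" "x \<subseteq> branch_set z" "infinite x"
  shows "\<exists>y. y \<subseteq> x \<and> infinite y \<and> y \<in> coded R"
proof -
  obtain Y where Y: "Y \<subseteq> {n. list_encode (pre z n) \<in> x}" "infinite Y"
      "\<And>j. finite {m \<in> Y. m < w j} \<and> card {m \<in> Y. m < w j} \<le> j"
    by (rule thin_subset[OF infinite_levels[OF assms(2,3)], of w]) blast
  let ?y = "(\<lambda>n. list_encode (pre z n)) ` Y"
  have inY: "list_encode (pre z m) \<in> ?y \<longleftrightarrow> m \<in> Y" for m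
    by (rule inj_image_mem_iff[OF inj_node])
  have "?y \<in> coded R"
    unfolding coded_def
  proof (intro CollectI allI impI)
    fix s assume "list_encode s \<in> ?y"
    then obtain n where n: "n \<in> Y" "s = pre z n" by (auto simp: list_encode_eq)
    have "card {m. m < length s \<and> m < w j \<and> list_encode (take m s) \<in> ?y} \<le> j" for j
    proof -
      have "m \<in> Y" if "m < length s" "list_encode (take m s) \<in> ?y" for m
      proof -
        have "take m s = pre z m" using that(1) by (simp add: n take_pre)
        thus ?thesis using that(2) inY[of m] by (simp only:)
      qed
      hence "{m. m < length s \<and> m < w j \<and> list_encode (take m s) \<in> ?y} \<subseteq> {m \<in> Y. m < w j}"
        by blast
      hence "card {m. m < length s \<and> m < w j \<and> list_encode (take m s) \<in> ?y} \<le> card {m \<in> Y. m < w j}"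
        using Y(3)[of j] by (intro card_mono) simp_all
      thus ?thesis using Y(3)[of j] by simp
    qed
    moreover have "pre z (length s) = s" by (simp add: n)
    ultimately show "\<exists>z w. (z, w) \<in> R \<and> pre z (length s) = s \<and>
        (\<forall>j. card {m. m < length s \<and> m < w j \<and> list_encode (take m s) \<in> ?y} \<le> j)"
      using assms(1) by blast
  qed
  moreover have "infinite ?y"
    using Y(2) finite_imageD[OF _ inj_on_subset[OF inj_node subset_UNIV]] by blast
  moreover have "?y \<subseteq> x" using Y(1) by auto
  ultimately show ?thesis by blast
qed

section \<open>Chains and antichains of finite sequences\<close>

lemma infinite_chain_branch:
  assumes "infinite H" "\<And>s t. s \<in> H \<Longrightarrow> t \<in> H \<Longrightarrow> prefix s t \<or> prefix t s"
  shows "\<exists>z. \<forall>s\<in>H. s = pre z (length s)"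
proof -
  have "inj_on length H"
  proof (rule inj_onI)
    fix s t assume "s \<in> H" "t \<in> H" "length s = length t"
    thus "s = t" using assms(2)[of s t] by (auto simp: prefix_def)
  qed
  hence "infinite (length ` H)" using assms(1) finite_imageD by blast
  hence "\<exists>s\<in>H. n < length s" for n
    unfolding infinite_nat_iff_unbounded by blast
  then obtain S where S: "\<And>n. S n \<in> H" "\<And>n. n < length (S n)" by metis
  \<comment> \<open>Lengths in \<open>H\<close> are unbounded because comparable lists of equal
    length coincide; by comparability the entry does not depend on which long enough member is
    read.\<close>
  define z where "z n = S n ! n" for n
  have "s = pre z (length s)" if s: "s \<in> H" for s
  proof (rule nth_equalityI)
    fix i assume i: "i < length s"
    have "s ! i = S i ! i"
      using assms(2)[OF s S(1)[of i]] i S(2)[of i] by (auto simp: prefix_def nth_append)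
    thus "s ! i = pre z (length s) ! i" using i by (simp add: pre_def z_def)
  qed simp
  thus ?thesis by blast
qed

text \<open>Ramsey's theorem for pairs coloured by comparability: a homogeneous set is an antichain
  or a chain, and an infinite chain lies on a branch.\<close>

lemma chain_or_antichain:
  assumes "infinite (x :: nat set)"
  obtains y where "y \<subseteq> x" "infinite y" "y \<in> antichains"
  | y z where "y \<subseteq> x" "infinite y" "y \<subseteq> branch_set z"
proof -
  define cmp where "cmp m n \<longleftrightarrow> prefix (list_decode m) (list_decode n) \<or> prefix (list_decode n) (list_decode m)" for m n
  define f :: "nat set \<Rightarrow> nat" where "f A = (if \<exists>m n. A = {m, n} \<and> m \<noteq> n \<and> cmp m n then 0 else 1)" for A
  have f: "f {m, n} = 0 \<longleftrightarrow> cmp m n" if "m \<noteq> n" for m n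
    using that unfolding f_def doubleton_eq_iff cmp_def by auto
  have "\<forall>m\<in>x. \<forall>n\<in>x. m \<noteq> n \<longrightarrow> f {m, n} < 2" by (simp add: f_def)
  from Ramsey2[OF assms this] obtain Y t where Y: "Y \<subseteq> x" "infinite Y"
    and "\<forall>m\<in>Y. \<forall>n\<in>Y. m \<noteq> n \<longrightarrow> f {m, n} = t" by blast
  hence Y3: "f {m, n} = t" if "m \<in> Y" "n \<in> Y" "m \<noteq> n" for m n
    using that by simp
  show ?thesis
  proof (cases "t = 0")
    case True
    have "cmp m n" if "m \<in> Y" "n \<in> Y" for m n
      using Y3[OF that] f[of m n] True by (cases "m = n") (simp_all add: cmp_def)
    hence "prefix s t \<or> prefix t s" if "s \<in> list_decode ` Y" "t \<in> list_decode ` Y" for s t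
      using that unfolding cmp_def by blast
    moreover have "inj_on list_decode Y" by (metis inj_onI list_decode_inverse)
    hence "infinite (list_decode ` Y)" using Y(2) finite_imageD by blast
    ultimately obtain z where z: "\<forall>s\<in>list_decode ` Y. s = pre z (length s)"
      using infinite_chain_branch[of "list_decode ` Y"] by blast
    have "m \<in> branch_set z" if "m \<in> Y" for m
      using z that node_in_branch_set[of "list_decode m" z] by simp
    hence "Y \<subseteq> branch_set z" by blast
    thus ?thesis by (rule that(2)[OF Y(1,2)])
  next
    case False
    have "Y \<in> antichains"
      unfolding antichains_def
    proof (intro CollectI allI impI)
      fix s t assume st: "list_encode s \<in> Y" "list_encode t \<in> Y" "prefix s t"
      show "s = t"
      proof (rule ccontr)
        assume "s \<noteq> t"
        hence "list_encode s \<noteq> list_encode t" by (simp add: list_encode_eq)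
        moreover have "cmp (list_encode s) (list_encode t)" using st(3) by (simp add: cmp_def)
        ultimately show False using Y3[OF st(1,2)] f False by metis
      qed
    qed
    thus ?thesis by (rule that(1)[OF Y(1,2)])
  qed
qed

text \<open>Any two initial segments of one branch are comparable.\<close>

lemma finite_antichain_branch:
  assumes "y \<in> antichains" "y \<subseteq> branch_set z"
  shows "finite y"
proof (rule ccontr)
  assume "infinite y"
  hence inf: "infinite {n. list_encode (pre z n) \<in> y}" using infinite_levels assms by blast
  then obtain m where m: "list_encode (pre z m) \<in> y" using not_finite_existsD by blast
  obtain n where n: "m < n" "list_encode (pre z n) \<in> y"
    using inf unfolding infinite_nat_iff_unbounded by blast
  have "prefix (pre z m) (pre z n)"
    using take_is_prefix[of m "pre z n"] n by (simp add: take_pre)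
  hence "pre z m = pre z n" using assms(1) m n unfolding antichains_def by blast
  thus False using n(1) by (metis length_pre less_irrefl)
qed

text \<open>Singletons are antichains.\<close>

lemma finite_in_gen:
  assumes "finite y" "antichains \<subseteq> K"
  shows "y \<in> gen K"
  using assms(1)
proof induction
  case empty
  show ?case by (rule gen_empty)
next
  case (insert a y)
  have "{a} \<in> antichains" unfolding antichains_def using list_encode_eq by fastforce
  hence "{a} \<in> gen K" using assms(2) subset_gen by blast
  thus ?case using insert gen_Un[of "{a}" K y] by simp
qed

section \<open>From a Borel selector to a separating Borel set\<close>

lemma continuous_branch_set: "continuous_on UNIV (\<lambda>z. to_cantor (branch_set z))"
proof (rule continuous_on_coordinatewise_then_product)
  fix n
  define s where "s = list_decode n"
  have n: "n = list_encode s" by (simp add: s_def)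
  have "n \<in> branch_set z \<longleftrightarrow> (\<forall>i\<in>{..<length s}. z i = s ! i)" for z
    unfolding n node_in_branch_set eq_commute[of s] pre_eq_list_iff Ball_def lessThan_iff ..
  hence eq: "to_cantor (branch_set z) n \<longleftrightarrow> z \<in> {g. \<forall>i\<in>{..<length s}. g i = s ! i}" for z
    by (simp add: to_cantor_def)
  have op: "open {g :: nat \<Rightarrow> nat. \<forall>i\<in>{..<length s}. g i = s ! i}"
    using open_cylinder[of "{..<length s}" "\<lambda>i. s ! i"] by simp
  have cl: "closed {g :: nat \<Rightarrow> nat. \<forall>i\<in>{..<length s}. g i = s ! i}"
    using closed_cylinder[of "{..<length s}" "\<lambda>i. s ! i"] .
  show "continuous_on UNIV (\<lambda>z. to_cantor (branch_set z) n)"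
    unfolding eq by (rule continuous_on_clopen[OF op cl])
qed

lemma borel_selector_separates:
  assumes S: "borel_selector (gen (antichains \<union> coded (strat True) \<union> coded (strat False))) S"
  shows False
proof -
  let ?G = "gen (antichains \<union> coded (strat True))"
  \<comment> \<open>\<open>D\<close> asks whether the selected set can be built without generators
    from \<open>coded (strat False)\<close>. It is a preimage of an F-sigma set under a Borel
    map.\<close>
  define D where "D = {z. S (branch_set z) \<in> ?G}"
  have "closed (to_cantor ` (antichains \<union> coded (strat True)))"
    by (simp add: image_Un closed_Un closed_antichains closed_coded)
  hence "fsigma_in euclidean (to_cantor ` ?G)"
    using gen_fsigma unfolding is_F_sigma_family_def by blast
  then obtain C :: "nat \<Rightarrow> (nat \<Rightarrow> bool) set" where "\<And>n. closed (C n)" "(\<Union>n. C n) = to_cantor ` ?G"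
    unfolding fsigma_in_ascending by auto
  hence "to_cantor ` ?G \<in> sets borel"
    by (metis (no_types, lifting) borel_closed sets.countable_UN image_subset_iff)
  moreover have "(\<lambda>z. to_cantor (S {n. to_cantor (branch_set z) n})) \<in> borel_measurable borel"
    using measurable_compose[OF borel_measurable_continuous_onI[OF continuous_branch_set]] S
    unfolding borel_selector_def by blast
  ultimately have "(\<lambda>z. to_cantor (S (branch_set z))) -` (to_cantor ` ?G) \<inter> space borel \<in> sets borel"
    using measurable_sets[of "\<lambda>z. to_cantor (S (branch_set z))" borel borel "to_cantor ` ?G"]
    by (simp add: to_cantor_def)
  moreover have "(\<lambda>z. to_cantor (S (branch_set z))) -` (to_cantor ` ?G) \<inter> space borel = D"
    unfolding to_cantor_image by (simp add: D_def to_cantor_def vimage_def)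
  ultimately have "D \<in> sets borel" by simp
  have "infinite (branch_set z)" for z
    unfolding branch_set_def using inj_node by (simp add: finite_image_iff)
  hence inf: "infinite (S (branch_set z))" and sub: "S (branch_set z) \<subseteq> branch_set z"
    and mem: "S (branch_set z) \<in> gen (antichains \<union> coded (strat True) \<union> coded (strat False))" for z
    using S unfolding borel_selector_def by simp_all
  have "D \<subseteq> fst ` strat True"
  proof
    fix z assume "z \<in> D"
    hence "S (branch_set z) \<in> ?G" by (simp add: D_def)
    \<comment> \<open>If \<open>z\<close> has no \<open>strat True\<close> strategy, each generator
      of \<open>?G\<close> inside the branch is finite, and so is a finite union of them. The
      inclusion is kept in the claim so that it passes to the parts of the union.\<close>
    hence "S (branch_set z) \<subseteq> branch_set z \<longrightarrow> z \<notin> fst ` strat True \<longrightarrow> finite (S (branch_set z))"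
    proof (induction rule: gen_induct)
      case (Un x y)
      have "finite y" if "y \<subseteq> branch_set z" "z \<notin> fst ` strat True"
        using Un.hyps(2) finite_antichain_branch[of y z] coded_branch[OF closed_strat, of y True z] that
        by blast
      thus ?case using Un.IH by simp
    qed auto
    thus "z \<in> fst ` strat True" using inf sub by blast
  qed
  moreover have "- fst ` strat False \<subseteq> D"
  proof
    fix z assume z: "z \<in> - fst ` strat False"
    from mem[of z] have "S (branch_set z) \<subseteq> branch_set z \<longrightarrow> S (branch_set z) \<in> ?G"
    proof (induction rule: gen_induct)
      case empty
      show ?case by (simp add: gen_empty)
    next
      case (Un x y)
      have "y \<in> ?G" if "y \<subseteq> branch_set z"
      proof (cases "y \<in> coded (strat False)")
        case True
        \<comment> \<open>Without a \<open>strat False\<close> strategy for \<open>z\<close> such a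
          part is finite, so finitely many singleton antichains replace it.\<close>
        hence "finite y" using coded_branch[OF closed_strat] that z by blast
        thus ?thesis by (intro finite_in_gen) auto
      next
        case False
        thus ?thesis using Un.hyps(2) subset_gen by blast
      qed
      thus ?case using Un.IH gen_Un[of x _ y] by simp
    qed
    thus "z \<in> D" using sub by (simp add: D_def)
  qed
  ultimately show False using strat_not_borel_separable \<open>D \<in> sets borel\<close> by blast
qed

theorem theorem4:
  shows "\<exists>I. is_ideal I \<and> tall I \<and> is_F_sigma_family I \<and> \<not> (\<exists>S. borel_selector I S)"
proof (intro exI conjI)
  let ?K = "antichains \<union> coded (strat True) \<union> coded (strat False)"
  show "is_ideal (gen ?K)"
    by (rule gen_ideal) (use antichains_subset coded_subset in blast)
  show "is_F_sigma_family (gen ?K)"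
    by (rule gen_fsigma) (simp add: image_Un closed_Un closed_antichains closed_coded)
  show "\<not> (\<exists>S. borel_selector (gen ?K) S)"
    using borel_selector_separates by blast
  show "tall (gen ?K)"
    unfolding tall_def
  proof (intro allI impI)
    fix x :: "nat set" assume "infinite x"
    thus "\<exists>y\<subseteq>x. infinite y \<and> y \<in> gen ?K"
    proof (cases rule: chain_or_antichain)
      case (1 y)
      have "y \<in> gen ?K" using 1(3) subset_gen[of ?K] by blast
      thus ?thesis using 1(1,2) by blast
    next
      case (2 y z)
      \<comment> \<open>Whichever player has a strategy for \<open>z\<close>, thinning the chain
        along it gives a generator.\<close>
      obtain b f where "(z, f) \<in> strat b" using strat_covers by blast
      then obtain y' where y': "y' \<subseteq> y" "infinite y'" "y' \<in> coded (strat b)"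
        using coded_thin[OF _ 2(3,2)] by blast
      hence "y' \<in> ?K" by (cases b) auto
      hence "y' \<in> gen ?K" using subset_gen[of ?K] by blast
      thus ?thesis using y'(1,2) 2(1) by blast
    qed
  qed
qed

end
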